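(* Let $p$ be a prime, $m\in\mathbb{N}$ with $m\ge 1$, $n=p^m$, and $S=\{a\in\mathbb{Z}_n \mid \gcd(a,n)=1\}$. Then the Cayley graph $\Gamma=\mathrm{Cay}(\mathbb{Z}_n,S)$ is a DS graph with respect to its adjacency spectrum.
   Context: For a finite group $G$ and an inverse-closed subset $H\subseteq G$ not containing the identity, $\mathrm{Cay}(G,H)$ is the simple undirected graph with vertex set $G$ in which $x,y$ are adjacent iff $x^{-1}y\in H$. Here $G=\mathbb{Z}_n$ is the additive cyclic group, so $x,y$ are adjacent iff $y-x\in S$. The adjacency spectrum of a finite simple graph is the multiset of eigenvalues of its adjacency matrix. A graph is DS (determined by its spectrum) with respect to its adjacency spectrum if every finite simple graph with the same adjacency spectrum is isomorphic to it. *)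

theory Defs
  imports
    "HOL-Algebra.Elementary_Groups"
    "HOL-Computational_Algebra.Fundamental_Theorem_Algebra"
    "Jordan_Normal_Form.Char_Poly"
    "Graph_Theory.Graph_Theory"
begin

text \<open>
  Finite simple graphs are modelled by the locale \<^locale>\<open>pair_graph\<close>: a finite vertex set
  together with a symmetric and irreflexive set of arcs, an edge being a pair of opposite arcs.
\<close>

definition cayley_graph :: "('a, 'b) monoid_scheme \<Rightarrow> 'a set \<Rightarrow> 'a pair_pre_digraph" where
  "cayley_graph G H =
    \<lparr>pverts = carrier G,
     parcs = {(x, y). x \<in> carrier G \<and> y \<in> carrier G \<and> inv\<^bsub>G\<^esub> x \<otimes>\<^bsub>G\<^esub> y \<in> H}\<rparr>"

lemma pair_graph_cayley_graph:
  assumes "group G" and "finite (carrier G)"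
    and HG: "H \<subseteq> carrier G" and inv: "\<And>h. h \<in> H \<Longrightarrow> inv\<^bsub>G\<^esub> h \<in> H" and one: "\<one>\<^bsub>G\<^esub> \<notin> H"
  shows "pair_graph (cayley_graph G H)"
proof -
  interpret group G by fact
  have sub: "parcs (cayley_graph G H) \<subseteq> carrier G \<times> carrier G"
    by (auto simp: cayley_graph_def)
  have fin: "finite (parcs (cayley_graph G H))"
    using finite_subset[OF sub] assms(2) by simp
  have sym: "inv\<^bsub>G\<^esub> y \<otimes>\<^bsub>G\<^esub> x \<in> H"
    if "x \<in> carrier G" "y \<in> carrier G" "inv\<^bsub>G\<^esub> x \<otimes>\<^bsub>G\<^esub> y \<in> H" for x y
    using inv[OF that(3)] that(1,2) by (simp add: inv_mult_group)
  show ?thesis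
  proof
    show "symmetric (with_proj (cayley_graph G H))"
      unfolding symmetric_def sym_def with_proj_simps using sym by (auto simp: cayley_graph_def)
  next
    show "finite (parcs (cayley_graph G H))" by (rule fin)
  qed (use assms(2) one in \<open>auto simp: cayley_graph_def\<close>)
qed

definition adjacency_matrix :: "'a pair_pre_digraph \<Rightarrow> 'a list \<Rightarrow> complex mat" where
  "adjacency_matrix G vs =
    mat (length vs) (length vs) (\<lambda>(i, j). if (vs ! i, vs ! j) \<in> parcs G then 1 else 0)"

text \<open>
  The spectrum is the multiset of complex roots of the characteristic polynomial, i.e. of the
  eigenvalues with multiplicities. The enumeration of the vertices is chosen arbitrarily; that the
  choice is irrelevant is shown in \<open>adjacency_spectrum_eq\<close> below.
\<close>

definition adjacency_spectrum :: "'a pair_pre_digraph \<Rightarrow> complex multiset" where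
  "adjacency_spectrum G =
    proots (char_poly (adjacency_matrix G (SOME vs. distinct vs \<and> set vs = pverts G)))"

lemma det_permute_rows_cols:
  fixes A :: "'a :: comm_ring_1 mat"
  assumes A: "A \<in> carrier_mat n n" and p: "p permutes {0..<n}"
  shows "det (mat n n (\<lambda>(i, j). A $$ (p i, p j))) = det A"
proof -
  have lt: "p i < n" if "i < n" for i
    using permutes_in_image[OF p, of i] that by auto
  define B where "B = mat n n (\<lambda>(i, j). A $$ (p i, j))"
  define C where "C = mat n n (\<lambda>(i, j). (transpose_mat B) $$ (p i, j))"
  have B: "B \<in> carrier_mat n n" and C: "C \<in> carrier_mat n n"
    by (auto simp: B_def C_def)
  have "mat n n (\<lambda>(i, j). A $$ (p i, p j)) = transpose_mat C"
    using lt by (auto simp: C_def B_def)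
  then have "det (mat n n (\<lambda>(i, j). A $$ (p i, p j))) = det C"
    using det_transpose[OF C] by simp
  also have "\<dots> = signof p * det (transpose_mat B)"
    unfolding C_def by (rule det_permute_rows[OF _ p]) (use B in auto)
  also have "\<dots> = signof p * (signof p * det A)"
    using det_transpose[OF B] det_permute_rows[OF A p] by (simp add: B_def)
  also have "\<dots> = det A"
    by (simp add: sign_def)
  finally show ?thesis .
qed

lemma char_poly_adjacency_matrix_eq:
  assumes "distinct vs" "distinct ws" "set vs = set ws"
  shows "char_poly (adjacency_matrix G vs) = char_poly (adjacency_matrix G ws)"
proof -
  define n where "n = length ws"
  have len: "length vs = n" unfolding n_def using assms by (metis distinct_card)
  have "mset vs = mset ws" using assms by (simp add: set_eq_iff_mset_eq_distinct)
  then obtain p where p: "p permutes {..<length ws}" and vs: "permute_list p ws = vs"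
    by (rule mset_eq_permutation)
  have p': "p permutes {0..<n}" using p by (simp add: n_def lessThan_atLeast0)
  have lt: "p i < n" if "i < n" for i
    using permutes_in_image[OF p', of i] that by auto
  have nth: "vs ! i = ws ! p i" if "i < n" for i
    using permute_list_nth[OF p, of i] that vs by (simp add: n_def)
  have inj: "p i = p j \<longleftrightarrow> i = j" for i j
    using permutes_inj[OF p'] by (auto simp: inj_def)
  let ?W = "char_poly_matrix (adjacency_matrix G ws)"
  have W: "?W \<in> carrier_mat n n"
    by (simp add: char_poly_matrix_def adjacency_matrix_def n_def)
  have "char_poly_matrix (adjacency_matrix G vs) = mat n n (\<lambda>(i, j). ?W $$ (p i, p j))"
    using lt nth by (auto simp: char_poly_matrix_def adjacency_matrix_def len n_def[symmetric] inj)
  then show ?thesis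
    using det_permute_rows_cols[OF W p'] by (simp add: char_poly_def)
qed

lemma adjacency_spectrum_eq:
  assumes "distinct vs" "set vs = pverts G"
  shows "adjacency_spectrum G = proots (char_poly (adjacency_matrix G vs))"
proof -
  let ?ws = "SOME vs. distinct vs \<and> set vs = pverts G"
  have "distinct ?ws \<and> set ?ws = pverts G"
    by (rule someI[of _ vs]) (use assms in auto)
  then show ?thesis
    unfolding adjacency_spectrum_def
    using char_poly_adjacency_matrix_eq[of ?ws vs G] assms by simp
qed

text \<open>
  HOL has no quantification over types inside a formula, so the type of the vertices of the
  competing graphs is a parameter. Leaving it a free type variable in a theorem quantifies over all
  of them.
\<close>

definition determined_by_spectrum :: "'b itself \<Rightarrow> 'a pair_pre_digraph \<Rightarrow> bool" where
  "determined_by_spectrum _ G \<longleftrightarrow>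
    pair_graph G \<and>
    (\<forall>H :: 'b pair_pre_digraph.
      pair_graph H \<and> adjacency_spectrum H = adjacency_spectrum G \<longrightarrow>
      digraph_iso (with_proj G) (with_proj H))"

end

theory Submission
  imports Defs "Jordan_Normal_Form.Schur_Decomposition"
begin

text \<open>
  Two residues are adjacent iff they differ modulo \<open>p\<close>, so the graph is complete multipartite with
  parts of size \<open>q = p ^ (m - 1)\<close> and regular of valency \<open>k = n - q\<close>. The spectrum of a graph determines the
  number of its vertices and, through the traces of the squared and cubed adjacency matrix, its numbers
  of edges and triangles. As in the Moon-Moser inequality, every edge \<open>uv\<close> lies in at least
  \<open>d(u) + d(v) - n\<close> triangles; summing over the edges and bounding the sum of the squared degrees from
  below by convexity bounds the number of triangles from below in terms of the numbers of
  vertices and edges. Equality holds for the given graph, hence for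
  every cospectral one, and it forces that graph to be regular of valency \<open>k\<close> and every vertex to be
  adjacent to an end of every edge. Then non-adjacency is an equivalence relation with classes of
  size \<open>q\<close>, which determines the graph up to isomorphism.
\<close>

section \<open>Traces of matrix powers as power sums of eigenvalues\<close>

definition mat_trace :: "'a :: comm_monoid_add mat \<Rightarrow> 'a" where
  "mat_trace A = (\<Sum>i<dim_row A. A $$ (i, i))"

lemma mat_trace_mult_commute:
  fixes A B :: "'a :: comm_semiring_0 mat"
  assumes "A \<in> carrier_mat n m" "B \<in> carrier_mat m n"
  shows "mat_trace (A * B) = mat_trace (B * A)"
proof -
  have "mat_trace (A * B) = (\<Sum>i<n. \<Sum>j<m. A $$ (i, j) * B $$ (j, i))"
    using assms by (auto simp: mat_trace_def scalar_prod_def lessThan_atLeast0 intro!: sum.cong)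
  also have "\<dots> = (\<Sum>j<m. \<Sum>i<n. B $$ (j, i) * A $$ (i, j))"
    by (subst sum.swap) (simp add: mult.commute)
  also have "\<dots> = mat_trace (B * A)"
    using assms by (auto simp: mat_trace_def scalar_prod_def lessThan_atLeast0 intro!: sum.cong)
  finally show ?thesis .
qed

lemma mat_trace_pow_similar:
  fixes A B :: "'a :: comm_semiring_1 mat"
  assumes "similar_mat_wit A B P Q"
  shows "mat_trace (A ^\<^sub>m k) = mat_trace (B ^\<^sub>m k)"
proof -
  obtain n where n: "n = dim_row A" by simp
  note wit = similar_mat_witD[OF n assms]
  have Bk: "B ^\<^sub>m k \<in> carrier_mat n n"
    using wit by (simp add: pow_carrier_mat)
  have "mat_trace (A ^\<^sub>m k) = mat_trace (P * B ^\<^sub>m k * Q)"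
    using similar_mat_wit_pow_id[OF assms] by simp
  also have "\<dots> = mat_trace (Q * (P * B ^\<^sub>m k))"
    using wit Bk by (intro mat_trace_mult_commute[of _ n n]) auto
  also have "Q * (P * B ^\<^sub>m k) = (Q * P) * B ^\<^sub>m k"
    using wit Bk by (intro assoc_mult_mat[symmetric, of _ n n _ n _ n]) auto
  also have "\<dots> = B ^\<^sub>m k"
    using wit Bk by simp
  finally show ?thesis .
qed

lemma upper_triangular_mult:
  fixes A B :: "'a :: semiring_0 mat"
  assumes A: "A \<in> carrier_mat n n" "upper_triangular A"
    and B: "B \<in> carrier_mat n n" "upper_triangular B"
  shows "upper_triangular (A * B)"
    and "i < n \<Longrightarrow> (A * B) $$ (i, i) = A $$ (i, i) * B $$ (i, i)"
proof -
  have entry: "(A * B) $$ (i, j) = (\<Sum>l<n. A $$ (i, l) * B $$ (l, j))" if "i < n" "j < n" for i j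
    using A B that by (auto simp: scalar_prod_def lessThan_atLeast0 intro!: sum.cong)
  \<comment> \<open>On or below the diagonal every product with \<open>l \<noteq> i\<close> dies:
    \<open>l < i\<close> kills the factor from \<open>A\<close>, and otherwise \<open>j < l\<close>
    kills the factor from \<open>B\<close>.\<close>
  have zero: "A $$ (i, l) * B $$ (l, j) = 0" if "i < n" "l < n" "j < i \<or> (j = i \<and> l \<noteq> i)" for i j l
  proof (cases "l < i")
    case True
    then show ?thesis using A that upper_triangularD[of A l i] by auto
  next
    case False
    then have "j < l" using that by auto
    then show ?thesis using B that upper_triangularD[of B j l] by auto
  qed
  show "upper_triangular (A * B)"
  proof (rule upper_triangularI)
    fix i j assume "j < i" "i < dim_row (A * B)"
    then show "(A * B) $$ (i, j) = 0"
      using A zero[of i _ j] by (simp add: entry)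
  qed
  show "(A * B) $$ (i, i) = A $$ (i, i) * B $$ (i, i)" if i: "i < n"
  proof -
    have "(A * B) $$ (i, i) = (\<Sum>l\<in>{i}. A $$ (i, l) * B $$ (l, i))"
      unfolding entry[OF i i] using i zero by (intro sum.mono_neutral_right) auto
    then show ?thesis by simp
  qed
qed

lemma upper_triangular_pow:
  fixes A :: "'a :: comm_semiring_1 mat"
  assumes A: "A \<in> carrier_mat n n" "upper_triangular A"
  shows "upper_triangular (A ^\<^sub>m k) \<and> (\<forall>i<n. (A ^\<^sub>m k) $$ (i, i) = A $$ (i, i) ^ k)"
proof (induction k)
  case 0
  then show ?case using A by auto
next
  case (Suc k)
  have Ak: "A ^\<^sub>m k \<in> carrier_mat n n" using A by (simp add: pow_carrier_mat)
  show ?case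
    using upper_triangular_mult[OF Ak _ A] Suc by (simp add: mult.commute)
qed

text \<open>By Schur, \<open>A\<close> is similar to an upper triangular matrix with the eigenvalues
  on its diagonal. Similarity preserves traces of powers, and the diagonal of a power of a
  triangular matrix consists of powers. Hence these traces are functions of the spectrum.\<close>

lemma mat_trace_pow_eq_sum_eigenvalues:
  fixes A :: "complex mat"
  assumes A: "A \<in> carrier_mat n n"
  shows "mat_trace (A ^\<^sub>m k) = (\<Sum>x\<in>#proots (char_poly A). x ^ k)"
proof -
  obtain es where es: "mset es = proots (char_poly A)"
    using ex_mset by blast
  \<comment> \<open>Over the complex numbers the monic characteristic polynomial splits into linear
    factors; as a product over the list \<open>es\<close> this is the premise of
    \<open>schur_decomposition\<close>.\<close>
  have "char_poly A = (\<Prod>x\<in>#proots (char_poly A). [:- x, 1:])"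
    using complex_poly_decompose_multiset[of "char_poly A"] degree_monic_char_poly[OF A] by simp
  then have cp: "char_poly A = (\<Prod>e\<leftarrow>es. [:- e, 1:])"
    by (simp add: es[symmetric] prod_mset_prod_list flip: mset_map)
  obtain B P Q where schur: "schur_decomposition A es = (B, P, Q)"
    by (cases "schur_decomposition A es") auto
  note sd = schur_decomposition[OF A cp schur]
  have B: "B \<in> carrier_mat n n" using similar_mat_witD2[OF A] sd by auto
  then have Bk: "B ^\<^sub>m k \<in> carrier_mat n n" by (simp add: pow_carrier_mat)
  have "mat_trace (A ^\<^sub>m k) = mat_trace (B ^\<^sub>m k)"
    using sd mat_trace_pow_similar by blast
  also have "\<dots> = (\<Sum>i<n. B $$ (i, i) ^ k)"
    using upper_triangular_pow[OF B] sd Bk by (auto simp: mat_trace_def)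
  also have "\<dots> = (\<Sum>x\<leftarrow>diag_mat B. x ^ k)"
    using B by (simp add: diag_mat_def o_def interv_sum_list_conv_sum_set_nat lessThan_atLeast0)
  also have "\<dots> = (\<Sum>x\<in>#proots (char_poly A). x ^ k)"
    using sd by (simp add: es[symmetric] sum_mset_sum_list flip: mset_map)
  finally show ?thesis .
qed

section \<open>Closed walks of length 2 and 3 as spectral invariants\<close>

definition adj :: "'a pair_pre_digraph \<Rightarrow> 'a \<Rightarrow> 'a \<Rightarrow> real" where
  "adj G u v = of_bool ((u, v) \<in> parcs G)"

lemma sum_nth_distinct:
  assumes "distinct vs"
  shows "(\<Sum>i<length vs. f (vs ! i)) = sum f (set vs)"
  using sum.reindex_bij_betw[OF bij_betw_nth[OF assms refl refl]] .

text \<open>The diagonal entries of a power count closed walks. For a simple graph the two sums are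
  twice the number of edges and six times the number of triangles.\<close>

lemma mat_trace_adjacency_matrix_pow:
  assumes "distinct vs" "set vs = pverts G"
  shows "mat_trace (adjacency_matrix G vs ^\<^sub>m 2) =
      of_real (\<Sum>u\<in>pverts G. \<Sum>v\<in>pverts G. adj G u v * adj G v u)" (is ?two)
    and "mat_trace (adjacency_matrix G vs ^\<^sub>m 3) =
      of_real (\<Sum>u\<in>pverts G. \<Sum>v\<in>pverts G. \<Sum>w\<in>pverts G. adj G u v * adj G v w * adj G w u)"
      (is ?three)
proof -
  define A where "A = adjacency_matrix G vs"
  define l where "l = length vs"
  have A: "A \<in> carrier_mat l l" by (simp add: A_def l_def adjacency_matrix_def)
  have entry: "A $$ (i, j) = of_real (adj G (vs ! i) (vs ! j))" if "i < l" "j < l" for i j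
    using that by (simp add: A_def l_def adjacency_matrix_def adj_def)
  have prod: "(X * A) $$ (i, j) = (\<Sum>s<l. X $$ (i, s) * of_real (adj G (vs ! s) (vs ! j)))"
    if "i < l" "j < l" "X \<in> carrier_mat l l" for X i j
    using A that by (auto simp: scalar_prod_def lessThan_atLeast0 entry intro!: sum.cong)
  note sums = sum_nth_distinct[OF assms(1), unfolded assms(2)]
  have "mat_trace (A ^\<^sub>m 2) =
      (\<Sum>i<l. \<Sum>j<l. of_real (adj G (vs ! i) (vs ! j) * adj G (vs ! j) (vs ! i)))"
    using A by (simp add: mat_trace_def numeral_2_eq_2 prod entry del: index_mult_mat(1))
  also have "\<dots> = of_real (\<Sum>u\<in>pverts G. \<Sum>v\<in>pverts G. adj G u v * adj G v u)"
    by (simp only: l_def sums of_real_sum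
      sums[of "\<lambda>v. of_real (adj G u v * adj G v u)" for u]
      sums[of "\<lambda>u. \<Sum>v\<in>pverts G. of_real (adj G u v * adj G v u)"])
  finally show ?two unfolding A_def .
  have AA: "A * A \<in> carrier_mat l l" using A by auto
  have "mat_trace (A ^\<^sub>m 3) = (\<Sum>i<l. \<Sum>s<l. \<Sum>j<l.
      of_real (adj G (vs ! i) (vs ! j) * adj G (vs ! j) (vs ! s) * adj G (vs ! s) (vs ! i)))"
    using A AA by (simp add: mat_trace_def numeral_3_eq_3 prod[OF _ _ A] prod[OF _ _ AA] entry
      sum_distrib_right del: index_mult_mat(1) assoc_mult_mat)
  \<comment> \<open>Expanding \<open>(A * A) * A\<close> leaves the second vertex of the walk as the
    innermost index; the swap restores the order in which the walk visits its vertices.\<close>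
  also have "\<dots> = (\<Sum>i<l. \<Sum>j<l. \<Sum>s<l.
      of_real (adj G (vs ! i) (vs ! j) * adj G (vs ! j) (vs ! s) * adj G (vs ! s) (vs ! i)))"
    by (rule sum.cong[OF refl], rule sum.swap)
  also have "\<dots> = of_real
      (\<Sum>u\<in>pverts G. \<Sum>v\<in>pverts G. \<Sum>w\<in>pverts G. adj G u v * adj G v w * adj G w u)"
    by (simp only: l_def of_real_sum
      sums[of "\<lambda>w. of_real (adj G u v * adj G v w * adj G w u)" for u v]
      sums[of "\<lambda>v. \<Sum>w\<in>pverts G. of_real (adj G u v * adj G v w * adj G w u)" for u]
      sums[of "\<lambda>u. \<Sum>v\<in>pverts G. \<Sum>w\<in>pverts G. of_real (adj G u v * adj G v w * adj G w u)"])
  finally show ?three unfolding A_def .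
qed

text \<open>The vertex count is the degree of the characteristic polynomial, hence the size of the
  spectrum. The other two counts are traces of the second and third power.\<close>

lemma cospectral_imp_same_counts:
  fixes G :: "'a pair_pre_digraph" and H :: "'b pair_pre_digraph"
  assumes "finite (pverts G)" "finite (pverts H)"
    and spec: "adjacency_spectrum G = adjacency_spectrum H"
  shows "card (pverts G) = card (pverts H)"
    and "(\<Sum>u\<in>pverts G. \<Sum>v\<in>pverts G. adj G u v * adj G v u) =
      (\<Sum>u\<in>pverts H. \<Sum>v\<in>pverts H. adj H u v * adj H v u)"
    and "(\<Sum>u\<in>pverts G. \<Sum>v\<in>pverts G. \<Sum>w\<in>pverts G. adj G u v * adj G v w * adj G w u) =
      (\<Sum>u\<in>pverts H. \<Sum>v\<in>pverts H. \<Sum>w\<in>pverts H. adj H u v * adj H v w * adj H w u)"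
proof -
  obtain vs where vs: "distinct vs" "set vs = pverts G"
    using finite_distinct_list[OF assms(1)] by blast
  obtain ws where ws: "distinct ws" "set ws = pverts H"
    using finite_distinct_list[OF assms(2)] by blast
  have A: "adjacency_matrix G vs \<in> carrier_mat (length vs) (length vs)"
    and B: "adjacency_matrix H ws \<in> carrier_mat (length ws) (length ws)"
    by (simp_all add: adjacency_matrix_def)
  have eq: "proots (char_poly (adjacency_matrix G vs)) = proots (char_poly (adjacency_matrix H ws))"
    using spec adjacency_spectrum_eq[OF vs] adjacency_spectrum_eq[OF ws] by simp
  have "length vs = length ws"
    using arg_cong[OF eq, of size] degree_monic_char_poly[OF A] degree_monic_char_poly[OF B]
    by (simp add: size_proots_complex)
  then show "card (pverts G) = card (pverts H)"
    using vs ws by (metis distinct_card)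
  have tr: "mat_trace (adjacency_matrix G vs ^\<^sub>m k) = mat_trace (adjacency_matrix H ws ^\<^sub>m k)" for k
    using eq by (simp add: mat_trace_pow_eq_sum_eigenvalues[OF A] mat_trace_pow_eq_sum_eigenvalues[OF B])
  show "(\<Sum>u\<in>pverts G. \<Sum>v\<in>pverts G. adj G u v * adj G v u) =
      (\<Sum>u\<in>pverts H. \<Sum>v\<in>pverts H. adj H u v * adj H v u)"
    using tr[of 2] unfolding mat_trace_adjacency_matrix_pow[OF vs]
      mat_trace_adjacency_matrix_pow[OF ws] of_real_eq_iff .
  show "(\<Sum>u\<in>pverts G. \<Sum>v\<in>pverts G. \<Sum>w\<in>pverts G. adj G u v * adj G v w * adj G w u) =
      (\<Sum>u\<in>pverts H. \<Sum>v\<in>pverts H. \<Sum>w\<in>pverts H. adj H u v * adj H v w * adj H w u)"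
    using tr[of 3] unfolding mat_trace_adjacency_matrix_pow[OF vs]
      mat_trace_adjacency_matrix_pow[OF ws] of_real_eq_iff .
qed

section \<open>Recognising complete equipartite graphs from their spectrum\<close>

text \<open>Multipartiteness is expressed through non-adjacency, whose classes are the parts. In a
  loopless graph each vertex is non-adjacent to itself, so \<open>q\<close> is the full size of a
  part. The number of parts is left open; the number of vertices fixes it.\<close>

definition complete_equipartite :: "nat \<Rightarrow> 'a pair_pre_digraph \<Rightarrow> bool" where
  "complete_equipartite q G \<longleftrightarrow>
    (\<forall>u\<in>pverts G. \<forall>v\<in>pverts G. \<forall>w\<in>pverts G.
      (u, v) \<notin> parcs G \<longrightarrow> (v, w) \<notin> parcs G \<longrightarrow> (u, w) \<notin> parcs G) \<and>
    (\<forall>u\<in>pverts G. card {v \<in> pverts G. (u, v) \<notin> parcs G} = q)"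

lemma pair_graph_arc_commute:
  assumes "pair_graph G"
  shows "(u, v) \<in> parcs G \<longleftrightarrow> (v, u) \<in> parcs G"
proof -
  interpret pair_graph G by fact
  show ?thesis using pair_sym_arcs by (auto simp: symmetric_def sym_def)
qed

lemma sum_adj:
  assumes "finite (pverts G)"
  shows "(\<Sum>v\<in>pverts G. adj G u v) =
    real (card (pverts G)) - real (card {v \<in> pverts G. (u, v) \<notin> parcs G})"
proof -
  have "(\<Sum>v\<in>pverts G. 1 - adj G u v) = (\<Sum>v\<in>pverts G. of_bool ((u, v) \<notin> parcs G))"
    by (intro sum.cong) (auto simp: adj_def)
  also have "\<dots> = real (card {v \<in> pverts G. (u, v) \<notin> parcs G})"
    using assms by (simp add: Int_def)
  finally show ?thesis by (simp add: sum_subtractf)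
qed

text \<open>
  The left-hand side is a sum of nonnegative terms that vanishes exactly for the complete
  multipartite graphs of valency \<open>k\<close>; the right-hand side depends on the spectrum only.
\<close>

lemma equipartite_defect:
  fixes k :: real
  assumes G: "pair_graph G"
  shows "(\<Sum>u\<in>pverts G. \<Sum>v\<in>pverts G. \<Sum>w\<in>pverts G. adj G u v * (1 - adj G u w) * (1 - adj G v w)) +
      2 * (\<Sum>u\<in>pverts G. ((\<Sum>v\<in>pverts G. adj G u v) - k)\<^sup>2) =
    (\<Sum>u\<in>pverts G. \<Sum>v\<in>pverts G. \<Sum>w\<in>pverts G. adj G u v * adj G v w * adj G w u) +
      (real (card (pverts G)) - 4 * k) * (\<Sum>u\<in>pverts G. \<Sum>v\<in>pverts G. adj G u v * adj G v u) +
      2 * real (card (pverts G)) * k\<^sup>2"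
proof -
  define V where "V = pverts G"
  define a where "a = adj G"
  define d where "d u = (\<Sum>v\<in>V. a u v)" for u
  define E where "E = (\<Sum>u\<in>V. d u)"
  define D where "D = (\<Sum>u\<in>V. (d u)\<^sup>2)"
  define t where "t = (\<Sum>u\<in>V. \<Sum>v\<in>V. \<Sum>w\<in>V. a u v * a v w * a w u)"
  have sym: "a u v = a v u" for u v
    using pair_graph_arc_commute[OF G] by (simp add: a_def adj_def)
  have sq: "a u v * a v u = a u v" for u v
    using pair_graph_arc_commute[OF G, of u v] by (simp add: a_def adj_def)
  have E: "(\<Sum>u\<in>V. \<Sum>v\<in>V. a u v * a v u) = E"
    by (simp add: E_def d_def sq)
  \<comment> \<open>The left side indicates an edge \<open>uv\<close> both of whose ends miss
    \<open>w\<close>. Expanding it produces edges, two kinds of paths of length 2 and closed walks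
    of length 3.\<close>
  have expand: "a u v * (1 - a u w) * (1 - a v w) =
      a u v - a u v * a u w - a u v * a v w + a u v * a v w * a w u" for u v w
    using sym[of u w] by (simp add: algebra_simps)
  have 1: "(\<Sum>u\<in>V. \<Sum>v\<in>V. \<Sum>w\<in>V. a u v) = real (card V) * E"
    by (simp add: E_def d_def sum_distrib_left)
  have 2: "(\<Sum>u\<in>V. \<Sum>v\<in>V. \<Sum>w\<in>V. a u v * a u w) = D"
    by (simp add: D_def d_def power2_eq_square sum_product)
  \<comment> \<open>Here the path has its centre at \<open>v\<close>; swapping the outer sums
    reduces this to the case with centre \<open>u\<close>.\<close>
  have "(\<Sum>u\<in>V. \<Sum>v\<in>V. \<Sum>w\<in>V. a u v * a v w) = (\<Sum>v\<in>V. \<Sum>u\<in>V. \<Sum>w\<in>V. a v u * a v w)"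
    by (subst sum.swap) (simp add: sym)
  then have 3: "(\<Sum>u\<in>V. \<Sum>v\<in>V. \<Sum>w\<in>V. a u v * a v w) = D"
    using 2 by simp
  have "(\<Sum>u\<in>V. \<Sum>v\<in>V. \<Sum>w\<in>V. a u v * (1 - a u w) * (1 - a v w)) = real (card V) * E - 2 * D + t"
    by (simp only: expand sum.distrib sum_subtractf 1 2 3 t_def)
  \<comment> \<open>Twice this variance contributes \<open>2 * D\<close>, which cancels the
    \<open>- 2 * D\<close> above. The sum of squared degrees is thereby eliminated, leaving only
    spectral quantities.\<close>
  moreover have "(\<Sum>u\<in>V. (d u - k)\<^sup>2) = D - 2 * k * E + real (card V) * k\<^sup>2"
    by (simp add: power2_diff sum.distrib sum_subtractf D_def E_def mult_ac
      flip: sum_distrib_left sum_distrib_right)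
  ultimately show ?thesis
    unfolding V_def[symmetric] a_def[symmetric] E d_def[symmetric] t_def[symmetric]
    by (simp add: algebra_simps)
qed

text \<open>The defect is zero for \<open>G\<close> and takes the same value for \<open>H\<close>,
  because its closed form involves only shared counts. As a sum of nonnegative terms it then
  vanishes termwise for \<open>H\<close>, which yields transitivity of non-adjacency and the part
  size.\<close>

lemma cospectral_complete_equipartite:
  assumes G: "pair_graph G" and H: "pair_graph H"
    and spec: "adjacency_spectrum H = adjacency_spectrum G"
    and part: "complete_equipartite q G"
  shows "complete_equipartite q H"
proof -
  interpret G: pair_graph G by fact
  interpret H: pair_graph H by fact
  note finG = G.pair_finite_verts and finH = H.pair_finite_verts
  note counts = cospectral_imp_same_counts[OF finH finG spec]
  \<comment> \<open>The common valency of \<open>G\<close>, so that its squared deviations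
    vanish.\<close>
  define k where "k = real (card (pverts G)) - real q"
  let ?T = "\<lambda>G. \<Sum>u\<in>pverts G. \<Sum>v\<in>pverts G. \<Sum>w\<in>pverts G. adj G u v * (1 - adj G u w) * (1 - adj G v w)"
  have nonneg: "0 \<le> adj H u v * (1 - adj H u w) * (1 - adj H v w)" for u v w
    by (simp add: adj_def)
  have "adj G u v * (1 - adj G u w) * (1 - adj G v w) = 0"
    if "u \<in> pverts G" "v \<in> pverts G" "w \<in> pverts G" for u v w
  proof -
    have "(u, v) \<notin> parcs G" if "(u, w) \<notin> parcs G" "(v, w) \<notin> parcs G"
      using part that \<open>u \<in> pverts G\<close> \<open>v \<in> pverts G\<close> \<open>w \<in> pverts G\<close>
        pair_graph_arc_commute[OF G, of v w]
      unfolding complete_equipartite_def by blast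
    then show ?thesis by (auto simp: adj_def)
  qed
  then have TG: "?T G = 0" by (simp del: mult_eq_0_iff)
  have DG: "(\<Sum>u\<in>pverts G. ((\<Sum>v\<in>pverts G. adj G u v) - k)\<^sup>2) = 0"
    using part by (simp add: sum_adj[OF finG] k_def complete_equipartite_def)
  have "?T H + 2 * (\<Sum>u\<in>pverts H. ((\<Sum>v\<in>pverts H. adj H u v) - k)\<^sup>2) = 0"
    \<comment> \<open>Replacing the counts of \<open>H\<close> by those of \<open>G\<close> gives
      the right-hand side for \<open>G\<close>, which is folded back into the defect of
      \<open>G\<close>.\<close>
    unfolding equipartite_defect[OF H] counts
    unfolding equipartite_defect[OF G, symmetric] TG DG by simp
  moreover have "?T H \<ge> 0" by (intro sum_nonneg nonneg)
  moreover have "(\<Sum>u\<in>pverts H. ((\<Sum>v\<in>pverts H. adj H u v) - k)\<^sup>2) \<ge> 0" by (intro sum_nonneg) simp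
  ultimately have TH: "?T H = 0" and DH: "(\<Sum>u\<in>pverts H. ((\<Sum>v\<in>pverts H. adj H u v) - k)\<^sup>2) = 0"
    by linarith+
  have zero: "adj H u v * (1 - adj H u w) * (1 - adj H v w) = 0"
    if u: "u \<in> pverts H" and v: "v \<in> pverts H" and w: "w \<in> pverts H" for u v w
  proof -
    have "(\<Sum>v\<in>pverts H. \<Sum>w\<in>pverts H. adj H u v * (1 - adj H u w) * (1 - adj H v w)) = 0"
      using TH u finH by (subst (asm) sum_nonneg_eq_0_iff) (auto intro!: sum_nonneg nonneg)
    then have "(\<Sum>w\<in>pverts H. adj H u v * (1 - adj H u w) * (1 - adj H v w)) = 0"
      using v finH by (subst (asm) sum_nonneg_eq_0_iff) (auto intro!: sum_nonneg nonneg)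
    then show ?thesis
      using w finH by (subst (asm) sum_nonneg_eq_0_iff) (auto intro!: nonneg)
  qed
  have "(u, w) \<notin> parcs H"
    if "u \<in> pverts H" "v \<in> pverts H" "w \<in> pverts H" "(u, v) \<notin> parcs H" "(v, w) \<notin> parcs H" for u v w
    \<comment> \<open>If \<open>uw\<close> were an edge, \<open>v\<close> would be adjacent to
      neither of its ends, making the term equal to 1.\<close>
    using zero[of u w v] that pair_graph_arc_commute[OF H, of v w] by (auto simp: adj_def)
  moreover have "card {v \<in> pverts H. (u, v) \<notin> parcs H} = q" if u: "u \<in> pverts H" for u
  proof -
    have "(\<Sum>v\<in>pverts H. adj H u v) = k"
      using DH u finH by (subst (asm) sum_nonneg_eq_0_iff) auto
    then show ?thesis
      using counts(1) by (simp add: sum_adj[OF finH] k_def)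
  qed
  ultimately show ?thesis unfolding complete_equipartite_def by blast
qed

section \<open>From equal part sizes to a graph isomorphism\<close>

text \<open>Equal class sizes on sets of equal cardinality force equally many classes. Classes are
  matched first, then the elements inside matched classes.\<close>

lemma equiv_bij_betw:
  fixes r :: "'a rel" and s :: "'b rel"
  assumes r: "equiv A r" and s: "equiv B s" and fin: "finite A" "finite B"
    and card: "card A = card B"
    and cr: "\<And>x. x \<in> A \<Longrightarrow> card (r `` {x}) = q" and cs: "\<And>y. y \<in> B \<Longrightarrow> card (s `` {y}) = q"
  obtains f where "bij_betw f A B"
    "\<And>x y. x \<in> A \<Longrightarrow> y \<in> A \<Longrightarrow> (f x, f y) \<in> s \<longleftrightarrow> (x, y) \<in> r"
proof -
  have fr: "finite X" if "X \<in> A // r" for X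
    using that fin r by (meson equiv_type finite_equiv_class)
  have fs: "finite Y" if "Y \<in> B // s" for Y
    using that fin s by (meson equiv_type finite_equiv_class)
  have qr: "card X = q" if "X \<in> A // r" for X
    using that cr by (auto elim: quotientE)
  have qs: "card Y = q" if "Y \<in> B // s" for Y
    using that cs by (auto elim: quotientE)
  have finq: "finite (A // r)" "finite (B // s)"
    using fin equiv_type[OF r] equiv_type[OF s] by (auto intro!: finite_quotient)
  have "q * card (A // r) = card (\<Union>(A // r))"
    using finq fin qr r quotient_disj[OF r] by (intro card_partition) (auto simp: Union_quotient)
  moreover have "q * card (B // s) = card (\<Union>(B // s))"
    using finq fin qs s quotient_disj[OF s] by (intro card_partition) (auto simp: Union_quotient)
  ultimately have qq: "q * card (A // r) = q * card (B // s)"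
    using card r s by (simp add: Union_quotient)
  have "card (A // r) = card (B // s)"
  \<comment> \<open>Cancelling \<open>q\<close> requires \<open>q \<noteq> 0\<close>. Since
    equivalence classes are nonempty, \<open>q = 0\<close> occurs only for empty \<open>A\<close>
    and \<open>B\<close>.\<close>
  proof (cases "q = 0")
    case True
    have "A = {}"
    proof (rule ccontr)
      assume "A \<noteq> {}"
      then obtain x where x: "x \<in> A" by blast
      then have "r `` {x} \<in> A // r" by (rule quotientI)
      then have "r `` {x} = {}" using cr[OF x] True fr by auto
      then show False using equiv_class_self[OF r x] by simp
    qed
    then show ?thesis using card fin by simp
  qed (use qq in simp)
  then obtain b where b: "bij_betw b (A // r) (B // s)"
    using finite_same_card_bij[OF finq] by blast
  have "\<exists>g. bij_betw g X (b X)" if "X \<in> A // r" for X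
    using that b bij_betwE[OF b] fr fs qr qs by (intro finite_same_card_bij) auto
  then obtain g where g: "\<And>X. X \<in> A // r \<Longrightarrow> bij_betw (g X) X (b X)"
    by metis
  \<comment> \<open>The bijections between matched classes are glued: each \<open>x\<close> is sent
    by the bijection chosen for its own class.\<close>
  define f where "f x = g (r `` {x}) x" for x
  have fb: "f x \<in> b (r `` {x})" if "x \<in> A" for x
    unfolding f_def using bij_betwE[OF g[OF quotientI[OF that]]] equiv_class_self[OF r that] by blast
  have bB: "b (r `` {x}) \<in> B // s" if "x \<in> A" for x
    using bij_betwE[OF b] quotientI[OF that] by blast
  have fB: "f x \<in> B" if "x \<in> A" for x
    using fb[OF that] bB[OF that] Union_quotient[OF s] by blast
  have rel: "(f x, f y) \<in> s \<longleftrightarrow> (x, y) \<in> r" if x: "x \<in> A" and y: "y \<in> A" for x y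
  proof -
    have "(f x, f y) \<in> s \<longleftrightarrow> b (r `` {x}) = b (r `` {y})"
      using quotient_eq_iff[OF s bB[OF x] bB[OF y] fb[OF x] fb[OF y]] by blast
    also have "\<dots> \<longleftrightarrow> r `` {x} = r `` {y}"
      using b quotientI[OF x, of r] quotientI[OF y, of r] by (auto simp: bij_betw_def inj_on_def)
    also have "\<dots> \<longleftrightarrow> (x, y) \<in> r"
      using eq_equiv_class_iff[OF r x y] .
    finally show ?thesis .
  qed
  have "inj_on f A"
  proof (rule inj_onI)
    fix x y assume x: "x \<in> A" and y: "y \<in> A" and eq: "f x = f y"
    have "(f x, f x) \<in> s" using equiv_class_self[OF s fB[OF x]] by blast
    then have xy: "(x, y) \<in> r" using rel[OF x y] eq by simp
    then have cl: "r `` {x} = r `` {y}" by (rule equiv_class_eq[OF r])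
    have "inj_on (g (r `` {x})) (r `` {x})"
      using g[OF quotientI[OF x]] by (simp add: bij_betw_def)
    then show "x = y"
      using eq xy equiv_class_self[OF r x] unfolding f_def cl[symmetric] by (auto dest: inj_onD)
  qed
  moreover have "f ` A = B"
    \<comment> \<open>Surjectivity comes from counting: an injective image of \<open>A\<close>
      inside \<open>B\<close> has the cardinality of \<open>B\<close>.\<close>
    using fB \<open>inj_on f A\<close> fin card by (intro card_subset_eq) (auto simp: card_image)
  ultimately show ?thesis using that[of f] rel by (simp add: bij_betw_def)
qed

lemma complete_equipartite_nonadjacency_equiv:
  assumes G: "pair_graph G" and part: "complete_equipartite q G"
  defines "r \<equiv> {(u, v) \<in> pverts G \<times> pverts G. (u, v) \<notin> parcs G}"
  shows "equiv (pverts G) r" and "u \<in> pverts G \<Longrightarrow> card (r `` {u}) = q"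
proof -
  interpret pair_graph G by fact
  show "equiv (pverts G) r"
  proof (rule equivI)
    show "r \<subseteq> pverts G \<times> pverts G" by (auto simp: r_def)
    show "refl_on (pverts G) r" using pair_no_loops by (force simp: r_def refl_on_def)
    show "sym r" using pair_graph_arc_commute[OF G] by (auto simp: r_def sym_def)
    show "trans r"
      using part unfolding r_def complete_equipartite_def by (auto intro!: transI)
  qed
  have "r `` {u} = {v \<in> pverts G. (u, v) \<notin> parcs G}" if "u \<in> pverts G"
    using that by (auto simp: r_def)
  then show "card (r `` {u}) = q" if "u \<in> pverts G"
    using that part by (simp add: complete_equipartite_def)
qed

lemma pair_digraph_isoI:
  assumes G: "pair_wf_digraph G" and H: "pair_wf_digraph H"
    and f: "bij_betw f (pverts G) (pverts H)"
    and arcs: "\<And>u v. u \<in> pverts G \<Longrightarrow> v \<in> pverts G \<Longrightarrow> (f u, f v) \<in> parcs H \<longleftrightarrow> (u, v) \<in> parcs G"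
  shows "digraph_iso (with_proj G) (with_proj H)"
proof -
  interpret G: pair_wf_digraph G by fact
  interpret H: pair_wf_digraph H by fact
  \<comment> \<open>Arcs are pairs of vertices, so the vertex map \<open>f\<close> forces the arc
    map, and tail and head remain the projections.\<close>
  define h where "h = \<lparr>iso_verts = f, iso_arcs = map_prod f f, iso_head = snd, iso_tail = fst\<rparr>"
  have inj: "inj_on f (pverts G)" and img: "f ` pverts G = pverts H"
    using f by (auto simp: bij_betw_def)
  have sub: "parcs G \<subseteq> pverts G \<times> pverts G"
    using G.arc_fst_in_verts G.arc_snd_in_verts by fastforce
  have "inj_on (map_prod f f) (parcs G)"
    using map_prod_inj_on[OF inj inj] sub by (rule inj_on_subset)
  then have "pre_digraph.digraph_isomorphism (with_proj G) h"
    using inj G.wf_digraph_axioms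
    by (auto simp: pre_digraph.digraph_isomorphism_def h_def)
  moreover have "map_prod f f ` parcs G = parcs H"
  proof (intro equalityI subsetI)
    fix e assume "e \<in> map_prod f f ` parcs G"
    then show "e \<in> parcs H" using arcs sub by auto
  next
    fix e assume e: "e \<in> parcs H"
    then have "fst e \<in> f ` pverts G" "snd e \<in> f ` pverts G"
      using H.arc_fst_in_verts H.arc_snd_in_verts img by auto
    then obtain u v where "u \<in> pverts G" "v \<in> pverts G" "e = (f u, f v)"
      by (metis imageE prod.collapse)
    then show "e \<in> map_prod f f ` parcs G" using e arcs by force
  qed
  then have "with_proj H = app_iso h (with_proj G)"
    using img by (simp add: app_iso_def h_def with_proj_def)
  ultimately show ?thesis unfolding digraph_iso_def by blast
qed

lemma complete_equipartite_iso:
  assumes G: "pair_graph G" and H: "pair_graph H"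
    and "complete_equipartite q G" "complete_equipartite q H"
    and card: "card (pverts G) = card (pverts H)"
  shows "digraph_iso (with_proj G) (with_proj H)"
proof -
  interpret G: pair_graph G by fact
  interpret H: pair_graph H by fact
  note eG = complete_equipartite_nonadjacency_equiv[OF G assms(3)]
    and eH = complete_equipartite_nonadjacency_equiv[OF H assms(4)]
  obtain f where f: "bij_betw f (pverts G) (pverts H)"
    and rel: "\<And>x y. x \<in> pverts G \<Longrightarrow> y \<in> pverts G \<Longrightarrow>
      (f x, f y) \<in> {(u, v) \<in> pverts H \<times> pverts H. (u, v) \<notin> parcs H} \<longleftrightarrow>
      (x, y) \<in> {(u, v) \<in> pverts G \<times> pverts G. (u, v) \<notin> parcs G}"
    using equiv_bij_betw[OF eG(1) eH(1) G.pair_finite_verts H.pair_finite_verts card eG(2) eH(2)]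
    by blast
  show ?thesis
  proof (rule pair_digraph_isoI[OF G.pair_wf_digraph_axioms H.pair_wf_digraph_axioms f])
    fix u v assume "u \<in> pverts G" "v \<in> pverts G"
    then show "(f u, f v) \<in> parcs H \<longleftrightarrow> (u, v) \<in> parcs G"
      using rel[of u v] bij_betwE[OF f] by auto
  qed
qed

section \<open>Residue classes and the unitary Cayley graph\<close>

text \<open>Each such \<open>y\<close> is determined by its quotient by \<open>p\<close>, since its
  remainder is that of \<open>x\<close>; the quotient ranges over \<open>q\<close> values.\<close>

lemma card_residue_class:
  fixes p q :: nat and x :: int
  assumes "p > 0"
  shows "card {y \<in> {0..<int (p * q)}. int p dvd y - x} = q"
proof -
  have p: "int p > 0" using assms by simp
  have "bij_betw (\<lambda>z. z * int p + x mod int p) {0..<int q}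
      {y \<in> {0..<int (p * q)}. int p dvd y - x}"
  proof (rule bij_betw_byWitness[where f' = "\<lambda>y. y div int p"])
    show "\<forall>z\<in>{0..<int q}. (z * int p + x mod int p) div int p = z"
      using p by simp
    show "\<forall>y\<in>{y \<in> {0..<int (p * q)}. int p dvd y - x}. y div int p * int p + x mod int p = y"
      by (auto simp: mod_eq_dvd_iff[symmetric] dest: sym)
    have "z * int p + x mod int p < int (p * q)" if "z < int q" for z
    proof -
      have "(z + 1) * int p \<le> int q * int p" using that p by (intro mult_right_mono) auto
      then show ?thesis using pos_mod_bound[OF p, of x] by (simp add: algebra_simps)
    qed
    then show "(\<lambda>z. z * int p + x mod int p) ` {0..<int q} \<subseteq> {y \<in> {0..<int (p * q)}. int p dvd y - x}"
      using p by (auto simp: mod_eq_dvd_iff[symmetric])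
    have "y div int p < int q" if "y < int (p * q)" for y
    proof -
      have "y div int p * int p \<le> y"
        using pos_mod_sign[OF p, of y] div_mult_mod_eq[of y "int p"] by linarith
      also have "y < int q * int p"
        using that by (simp add: mult.commute)
      finally have "y div int p * int p < int q * int p" .
      then show ?thesis using p by (simp add: mult_less_cancel_right)
    qed
    then show "(\<lambda>y. y div int p) ` {y \<in> {0..<int (p * q)}. int p dvd y - x} \<subseteq> {0..<int q}"
      using p by (auto simp: pos_imp_zdiv_nonneg_iff)
  qed
  from bij_betw_same_card[OF this] show ?thesis by simp
qed

theorem theorem3p2:
  fixes p m n :: nat and S :: "int set" and \<Gamma> :: "int pair_pre_digraph"
  assumes "prime p" and "m \<ge> 1" and "n = p ^ m"
    and "S = {a \<in> carrier (integer_mod_group n). gcd a (int n) = 1}"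
    and "\<Gamma> = cayley_graph (integer_mod_group n) S"
  shows "determined_by_spectrum TYPE('b) \<Gamma>"
proof -
  \<comment> \<open>The size of a part: each residue class modulo \<open>p\<close> has
    \<open>n / p\<close> members in \<int> modulo \<open>n\<close>. Here \<open>m \<ge> 1\<close>
    ensures \<open>n = p * q\<close>.\<close>
  define q where "q = p ^ (m - 1)"
  have n: "n = p * q" using assms(2,3) by (cases m) (auto simp: q_def)
  have p: "p > 1" using assms(1) by (rule prime_gt_1_nat)
  have n0: "n > 0" using p assms(3) by simp
  have carrier: "carrier (integer_mod_group n) = {0..<int n}"
    using n0 by (simp add: carrier_integer_mod_group)
  \<comment> \<open>Since \<open>p\<close> is the only prime divisor of \<open>n\<close>,
    coprimality to \<open>n\<close> means non-divisibility by \<open>p\<close>.\<close>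
  have cop: "gcd a (int n) = 1 \<longleftrightarrow> \<not> int p dvd a" for a
  proof -
    have "gcd a (int n) = 1 \<longleftrightarrow> coprime a (int p ^ m)"
      using assms(3) by (simp add: coprime_iff_gcd_eq_1)
    also have "\<dots> \<longleftrightarrow> coprime (int p) a"
      using assms(2) by (simp add: coprime_commute)
    also have "\<dots> \<longleftrightarrow> \<not> int p dvd a"
      using assms(1) by (metis prime_imp_coprime coprime_absorb_left
        not_prime_unit prime_nat_int_transfer)
    finally show ?thesis .
  qed
  \<comment> \<open>As \<open>p\<close> divides \<open>n\<close>, reduction modulo \<open>n\<close>
    in the group operations does not affect divisibility by \<open>p\<close>; adjacency can be
    tested on integer differences.\<close>
  have dvd_mod: "int p dvd a mod int n \<longleftrightarrow> int p dvd a" for a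
    using n by (intro dvd_mod_iff) simp
  have verts: "pverts \<Gamma> = {0..<int n}"
    by (simp add: assms(5) cayley_graph_def carrier)
  have arc: "(x, y) \<in> parcs \<Gamma> \<longleftrightarrow> \<not> int p dvd y - x" if "x \<in> pverts \<Gamma>" "y \<in> pverts \<Gamma>" for x y
  proof -
    have "int p dvd (- x mod int n + y) mod int n \<longleftrightarrow> int p dvd y - x"
      using dvd_mod[of "y - x"] by (simp add: mod_add_left_eq)
    then show ?thesis
      using that n0 by (simp add: verts assms(4,5) cayley_graph_def carrier cop)
  qed
  have graph: "pair_graph \<Gamma>"
    unfolding assms(5)
  proof (rule pair_graph_cayley_graph)
    fix h assume "h \<in> S"
    then show "inv\<^bsub>integer_mod_group n\<^esub> h \<in> S"
      using n0 by (simp add: assms(4) carrier cop dvd_mod)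
  qed (auto simp: assms(4) carrier cop)
  have part: "complete_equipartite q \<Gamma>"
    unfolding complete_equipartite_def
  proof (intro conjI ballI impI)
    fix u v w assume V: "u \<in> pverts \<Gamma>" "v \<in> pverts \<Gamma>" "w \<in> pverts \<Gamma>"
      and "(u, v) \<notin> parcs \<Gamma>" "(v, w) \<notin> parcs \<Gamma>"
    then have "int p dvd (v - u) + (w - v)" by (intro dvd_add) (auto simp: arc)
    then show "(u, w) \<notin> parcs \<Gamma>" using V by (simp add: arc)
  next
    fix u assume "u \<in> pverts \<Gamma>"
    then have "{v \<in> pverts \<Gamma>. (u, v) \<notin> parcs \<Gamma>} = {y \<in> {0..<int (p * q)}. int p dvd y - u}"
      using arc verts n by auto
    then show "card {v \<in> pverts \<Gamma>. (u, v) \<notin> parcs \<Gamma>} = q"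
      using card_residue_class[of p q u] p by simp
  qed
  have "digraph_iso (with_proj \<Gamma>) (with_proj H)"
    if H: "pair_graph H" and spec: "adjacency_spectrum H = adjacency_spectrum \<Gamma>"
    for H :: "'b pair_pre_digraph"
  proof (rule complete_equipartite_iso[OF graph H part])
    show "complete_equipartite q H"
      by (rule cospectral_complete_equipartite[OF graph H spec part])
    interpret H: pair_graph H by fact
    show "card (pverts \<Gamma>) = card (pverts H)"
      using cospectral_imp_same_counts(1)[OF H.pair_finite_verts _ spec] verts by simp
  qed
  then show ?thesis
    using graph by (simp add: determined_by_spectrum_def)
qed

end
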